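(* For every $\varepsilon>0$ there exist $C_\varepsilon,D_\varepsilon>0$ such that for all $n\in\mathbb{N}$, $$\frac{\#\{f\in\mathbb{F}_2[x]:\deg(f)=n,\ (2-\varepsilon)n\le\tau(f)\le(2+\varepsilon)n\}}{2^n}\ge 1-C_\varepsilon e^{-D_\varepsilon\sqrt{n}}.$$
   Context: Define $T:\mathbb{F}_2[x]\to\mathbb{F}_2[x]$ by $T(f)=\frac{f}{x+1}$ if $f(1)=0$ and $T(f)=\frac{xf+1}{x+1}$ if $f(1)=1$. For nonzero $f$, $\tau(f)$ is the least $k\in\mathbb{N}$ with $T^k(f)=1$ (this is finite). *)

theory Defs
  imports "HOL-Analysis.Analysis" "HOL-Library.Z2" "HOL-Computational_Algebra.Polynomial"
begin

definition T_map :: "bit poly \<Rightarrow> bit poly" where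
  "T_map f = (if poly f 1 = 0 then f div [:1, 1:]
              else ([:0, 1:] * f + 1) div [:1, 1:])"

text \<open>tau f = least k with T^k(f) = 1 (meaningful for nonzero f).\<close>
definition tau :: "bit poly \<Rightarrow> nat" where
  "tau f = (LEAST k. (T_map ^^ k) f = 1)"

end

theory Submission
  imports Defs "HOL-Probability.Hoeffding" "HOL-Real_Asymp.Real_Asymp"
begin

text \<open>
  Call the value \<open>f 1\<close> the parity of \<open>f\<close>. An even step lowers the degree by one and an odd step
  preserves it, so \<open>tau f\<close> is the degree plus the number of odd steps. The first \<open>m\<close> parities
  determine a polynomial of degree \<open>m\<close>, so on the \<open>2 ^ m\<close> polynomials of degree \<open>m\<close> they are
  uniform coin flips; by Hoeffding's inequality, for all but a proportion \<open>2 exp (-2 \<delta>\<^sup>2 m)\<close> of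
  them the first \<open>m\<close> steps lead to degree \<open>m / 2\<close> up to an error \<open>\<delta> m\<close>. To iterate this along the
  orbit of a random \<open>f\<close> of degree \<open>n\<close>, observe that the value of the iterate at a fixed time
  determines the leading \<open>m + 1\<close> coefficients of \<open>f\<close>, where \<open>m\<close> is the degree of that iterate; so
  each value has at most \<open>2 ^ (n - m)\<close> preimages. A union bound over the times and over the degrees
  \<open>m\<close> of order at least \<open>sqrt n\<close> shows that typically all iterates of such degrees nearly halve
  their degree, and then summing \<open>m + m / 2 + m / 4 + \<dots>\<close> gives \<open>tau f\<close> close to \<open>2 n\<close>. Below
  degree of order \<open>sqrt n\<close> the deterministic quadratic bound on \<open>tau\<close> suffices; this is the origin
  of the exponent \<open>sqrt n\<close>.
\<close>

section \<open>Polynomials of bounded degree\<close>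

definition polys_below :: "nat \<Rightarrow> 'a::zero poly set" where
  "polys_below n = {p. p = 0 \<or> degree p < n}"

definition polys_of_degree :: "nat \<Rightarrow> 'a::zero poly set" where
  "polys_of_degree n = {p. p \<noteq> 0 \<and> degree p = n}"

lemma polys_below_Suc: "polys_below (Suc n) = (\<lambda>(a, p). pCons a p) ` (UNIV \<times> polys_below n)"
proof (rule set_eqI)
  fix p :: "'a poly"
  obtain a q where "p = pCons a q" by (cases p)
  then show "p \<in> polys_below (Suc n) \<longleftrightarrow> p \<in> (\<lambda>(a, p). pCons a p) ` (UNIV \<times> polys_below n)"
    by (auto simp: polys_below_def)
qed

lemma card_polys_below: "card (polys_below n :: 'a::zero poly set) = CARD('a) ^ n"
proof (induction n)
  case 0
  have "polys_below 0 = {0 :: 'a poly}" by (auto simp: polys_below_def)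
  then show ?case by simp
next
  case (Suc n)
  have "inj_on (\<lambda>(a :: 'a, p). pCons a p) (UNIV \<times> polys_below n)" by (auto simp: inj_on_def)
  then show ?case
    using Suc by (simp add: polys_below_Suc card_image card_cartesian_product)
qed

lemma polys_of_degree_eq_Diff: "polys_of_degree n = polys_below (Suc n) - polys_below n"
  by (auto simp: polys_below_def polys_of_degree_def)

lemma polys_below_add: "p \<in> polys_below n \<Longrightarrow> q \<in> polys_below n \<Longrightarrow> p + q \<in> polys_below n"
  by (auto simp: polys_below_def intro: degree_add_less)

lemma polys_below_diff:
  fixes p q :: "'a::ab_group_add poly"
  shows "p \<in> polys_below n \<Longrightarrow> q \<in> polys_below n \<Longrightarrow> p - q \<in> polys_below n"
  by (auto simp: polys_below_def intro: degree_diff_less)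

lemma UNIV_bit: "(UNIV :: bit set) = {0, 1}"
  by (auto intro: bit.exhaust)

lemma card_UNIV_bit: "CARD(bit) = 2"
  unfolding UNIV_bit by simp

lemma finite_polys_below_bit: "finite (polys_below n :: bit poly set)"
  by (rule card_ge_0_finite) (simp add: card_polys_below card_UNIV_bit)

lemma finite_polys_of_degree_bit: "finite (polys_of_degree n :: bit poly set)"
  by (simp add: polys_of_degree_eq_Diff finite_polys_below_bit)

lemma card_polys_of_degree_bit: "card (polys_of_degree n :: bit poly set) = 2 ^ n"
proof -
  have "polys_below n \<subseteq> (polys_below (Suc n) :: bit poly set)" by (auto simp: polys_below_def)
  then show ?thesis
    by (simp add: polys_of_degree_eq_Diff card_Diff_subset finite_polys_below_bit
        card_polys_below card_UNIV_bit)
qed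

lemma polys_of_degree_diff_bit:
  fixes f g :: "bit poly"
  assumes "f \<in> polys_of_degree n" "g \<in> polys_of_degree n"
  shows "f - g \<in> polys_below n"
proof -
  have "coeff h n = 1" if "h \<in> polys_of_degree n" for h :: "bit poly"
    using that leading_coeff_0_iff[of h] by (cases "coeff h n") (auto simp: polys_of_degree_def)
  then have "coeff (f - g) n = 0" using assms by simp
  moreover have "degree (f - g) \<le> n"
    using assms by (auto simp: polys_of_degree_def intro: degree_diff_le)
  ultimately show ?thesis
    unfolding polys_below_def by (metis (mono_tags) eq_zero_or_degree_less mem_Collect_eq)
qed

lemma degree_0_bit: "f \<noteq> 0 \<Longrightarrow> degree f = 0 \<Longrightarrow> f = 1" for f :: "bit poly"
  using polys_of_degree_diff_bit[of f 0 1] by (simp add: polys_below_def polys_of_degree_def)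

section \<open>Parities along an orbit\<close>

declare mult_pCons_left [simp del] mult_pCons_right [simp del]

lemma T_map_times: "[:1, 1:] * T_map f = (if poly f 1 = 0 then f else [:0, 1:] * f + 1)"
proof -
  have dvd_of_root: "[:1, 1:] dvd p" if "poly p 1 = 0" for p :: "bit poly"
    using that poly_eq_0_iff_dvd[of p 1] by simp
  show ?thesis
    using dvd_of_root[of f] dvd_of_root[of "[:0, 1:] * f + 1"] by (simp add: T_map_def)
qed

lemma T_map_1 [simp]: "T_map 1 = 1"
proof -
  have "[:1, 1:] * T_map 1 = [:1, 1:] * 1"
    by (subst T_map_times) (simp add: one_pCons mult_pCons_left)
  then show ?thesis by simp
qed

lemma T_map_funpow_1 [simp]: "(T_map ^^ k) 1 = 1"
  by (induction k) simp_all

lemma T_map_nonzero: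
  assumes "f \<noteq> 0" shows "T_map f \<noteq> 0"
proof -
  have "poly ([:0, 1:] * f + 1) 0 \<noteq> 0" by simp
  then have "[:0, 1:] * f + 1 \<noteq> 0" by (metis poly_0)
  then show ?thesis using T_map_times[of f] assms by (auto split: if_splits)
qed

lemma T_map_funpow_nonzero: "f \<noteq> 0 \<Longrightarrow> (T_map ^^ k) f \<noteq> 0"
  by (induction k) (simp_all add: T_map_nonzero)

lemma degree_T_map:
  assumes "f \<noteq> 0"
  shows "Suc (degree (T_map f)) = degree f + of_bool (poly f 1 = 1)"
proof -
  have "degree ([:0, 1:] * f + 1) = Suc (degree f)"
    using assms by (subst degree_add_eq_left) (simp_all add: degree_mult_eq)
  moreover have "degree ([:1, 1:] * T_map f) = Suc (degree (T_map f))"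
    using T_map_nonzero[OF assms] by (subst degree_mult_eq) auto
  ultimately show ?thesis by (simp add: T_map_times split: if_splits)
qed

definition odd_times :: "nat \<Rightarrow> bit poly \<Rightarrow> nat set" where
  "odd_times k f = {i. i < k \<and> poly ((T_map ^^ i) f) 1 = 1}"

lemma odd_times_0 [simp]: "odd_times 0 f = {}"
  by (simp add: odd_times_def)

lemma odd_times_1: "odd_times k 1 = {..<k}"
  by (auto simp: odd_times_def)

lemma odd_times_subset: "odd_times k f \<subseteq> {..<k}"
  by (auto simp: odd_times_def)

lemma odd_times_Suc:
  "odd_times (Suc k) f =
    (if poly ((T_map ^^ k) f) 1 = 1 then insert k (odd_times k f) else odd_times k f)"
  by (auto simp: odd_times_def less_Suc_eq)

lemma odd_times_Suc_eqD:
  assumes "odd_times (Suc k) f = odd_times (Suc k) g"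
  shows "odd_times k f = odd_times k g"
    and "poly ((T_map ^^ k) f) 1 = poly ((T_map ^^ k) g) 1"
proof -
  have "odd_times k h = odd_times (Suc k) h - {k}" for h by (auto simp: odd_times_def)
  then show "odd_times k f = odd_times k g" using assms by simp
  have "poly ((T_map ^^ k) h) 1 = of_bool (k \<in> odd_times (Suc k) h)" for h
    by (simp add: odd_times_def)
  then show "poly ((T_map ^^ k) f) 1 = poly ((T_map ^^ k) g) 1" using assms by simp
qed

lemma card_odd_times_Suc:
  "card (odd_times (Suc k) f) = card (odd_times k f) + of_bool (poly ((T_map ^^ k) f) 1 = 1)"
proof -
  have "finite (odd_times k f)" "k \<notin> odd_times k f" by (auto simp: odd_times_def)
  then show ?thesis by (simp add: odd_times_Suc)
qed

lemma card_odd_times_le: "card (odd_times k f) \<le> k"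
  using card_mono[OF _ odd_times_subset, of k f] by simp

lemma degree_T_map_funpow:
  assumes "f \<noteq> 0"
  shows "degree ((T_map ^^ k) f) + k = degree f + card (odd_times k f)"
proof (induction k)
  case (Suc k)
  then show ?case
    using degree_T_map[OF T_map_funpow_nonzero[OF assms, of k]] by (simp add: card_odd_times_Suc)
qed simp

lemma degree_T_map_funpow_le: "f \<noteq> 0 \<Longrightarrow> degree ((T_map ^^ k) f) \<le> degree f"
  using degree_T_map_funpow[of f k] card_odd_times_le[of k f] by simp

lemma degree_T_map_funpow_degree:
  "f \<noteq> 0 \<Longrightarrow> degree ((T_map ^^ degree f) f) = card (odd_times (degree f) f)"
  using degree_T_map_funpow[of f "degree f"] by simp

lemma T_map_funpow_Suc_times:
  "[:1, 1:] ^ Suc k * (T_map ^^ Suc k) f = [:1, 1:] ^ k *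
    (if poly ((T_map ^^ k) f) 1 = 0 then (T_map ^^ k) f else [:0, 1:] * (T_map ^^ k) f + 1)"
  using T_map_times[of "(T_map ^^ k) f"]
  by (simp only: power_Suc2 mult.assoc funpow.simps comp_apply)

text \<open>Since \<open>c\<close> does not depend on \<open>g\<close>, the parities determine a polynomial; since \<open>c\<close> has low
  degree, the value of an iterate determines the leading coefficients.\<close>
lemma T_map_funpow_affine:
  "\<exists>c \<in> polys_below k. \<forall>g. odd_times k g = odd_times k f \<longrightarrow>
     [:1, 1:] ^ k * (T_map ^^ k) g = [:0, 1:] ^ card (odd_times k f) * g + c"
proof (induction k)
  case 0
  show ?case by (auto simp: polys_below_def)
next
  case (Suc k)
  let ?j = "card (odd_times k f)"
  obtain c where c: "c \<in> polys_below k"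
    and IH: "[:1, 1:] ^ k * (T_map ^^ k) g = [:0, 1:] ^ ?j * g + c"
      if "odd_times k g = odd_times k f" for g
    using Suc by blast
  show ?case
  proof (cases "poly ((T_map ^^ k) f) 1 = 0")
    case True
    have "[:1, 1:] ^ Suc k * (T_map ^^ Suc k) g = [:0, 1:] ^ ?j * g + c"
      if "odd_times (Suc k) g = odd_times (Suc k) f" for g
      using T_map_funpow_Suc_times[of k g] odd_times_Suc_eqD[OF that] IH True by simp
    moreover have "c \<in> polys_below (Suc k)" using c by (auto simp: polys_below_def)
    ultimately show ?thesis using True by (auto simp: card_odd_times_Suc simp del: power_Suc)
  next
    case False
    let ?c = "[:0, 1:] * c + [:1, 1:] ^ k"
    have "[:1, 1:] ^ Suc k * (T_map ^^ Suc k) g = [:0, 1:] ^ Suc ?j * g + ?c"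
      if same: "odd_times (Suc k) g = odd_times (Suc k) f" for g
    proof -
      have "[:1, 1:] ^ Suc k * (T_map ^^ Suc k) g
          = [:0, 1:] * ([:1, 1:] ^ k * (T_map ^^ k) g) + [:1, 1:] ^ k"
        using T_map_funpow_Suc_times[of k g] odd_times_Suc_eqD(2)[OF same] False
        by (simp add: algebra_simps)
      then show ?thesis
        unfolding IH[OF odd_times_Suc_eqD(1)[OF same]] by (simp add: algebra_simps)
    qed
    moreover have "?c \<in> polys_below (Suc k)"
      using c by (intro polys_below_add)
        (auto simp: polys_below_def degree_power_eq mult_pCons_left)
    ultimately show ?thesis using False by (auto simp: card_odd_times_Suc simp del: power_Suc)
  qed
qed

lemma T_map_funpow_diff:
  assumes "odd_times k f = odd_times k g"
  shows "[:1, 1:] ^ k * ((T_map ^^ k) f - (T_map ^^ k) g)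
    = [:0, 1:] ^ card (odd_times k f) * (f - g)"
  using T_map_funpow_affine[of k f] assms by (auto simp: right_diff_distrib)

lemma odd_times_eq_imp_eq:
  assumes "odd_times k f = odd_times k g" "f - g \<in> polys_below k"
  shows "f = g"
proof (rule ccontr)
  assume "f \<noteq> g"
  define j where "j = card (odd_times k f)"
  define F G where "F = (T_map ^^ k) f" and "G = (T_map ^^ k) g"
  have diff_eq: "[:1, 1:] ^ k * (F - G) = [:0, 1:] ^ j * (f - g)"
    unfolding F_def G_def j_def using assms(1) by (rule T_map_funpow_diff)
  have nonzero: "[:0, 1:] ^ j * (f - g) \<noteq> 0" using \<open>f \<noteq> g\<close> by simp
  have "order 1 ([:1, 1 :: bit:] ^ k) = k" using order_power_n_n[of "1 :: bit" k] by simp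
  then have "k \<le> order 1 ([:1, 1:] ^ k * (F - G))"
    using nonzero unfolding diff_eq[symmetric] by (subst order_mult) auto
  also have "\<dots> = order 1 ([:0, 1:] ^ j :: bit poly) + order 1 (f - g)"
    unfolding diff_eq using nonzero by (rule order_mult)
  also have "\<dots> = order 1 (f - g)" by (simp add: order_0I)
  also have "\<dots> \<le> degree (f - g)" using \<open>f \<noteq> g\<close> by (intro order_degree) simp
  finally show False using assms(2) \<open>f \<noteq> g\<close> by (simp add: polys_below_def)
qed

lemma inj_on_odd_times: "inj_on (odd_times n) (polys_of_degree n)"
  by (intro inj_onI) (metis odd_times_eq_imp_eq polys_of_degree_diff_bit)

lemma T_map_funpow_eq_imp_diff:
  assumes f: "f \<in> polys_of_degree n" and g: "g \<in> polys_of_degree n"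
    and same_value: "(T_map ^^ k) f = (T_map ^^ k) g"
  shows "f - g \<in> polys_below (n - degree ((T_map ^^ k) f))"
proof (cases "f = g")
  case True
  then show ?thesis by (simp add: polys_below_def)
next
  case False
  define j where "j = card (odd_times k f)"
  have degree_iterate: "degree ((T_map ^^ k) f) + k = n + j"
    using degree_T_map_funpow[of f k] f by (simp add: polys_of_degree_def j_def)
  have odd_count_g: "card (odd_times k g) = j"
    using degree_T_map_funpow[of g k] g same_value degree_iterate by (simp add: polys_of_degree_def)
  obtain c where c: "c \<in> polys_below k" "[:1, 1:] ^ k * (T_map ^^ k) f = [:0, 1:] ^ j * f + c"
    using T_map_funpow_affine[of k f] unfolding j_def by blast
  obtain d where d: "d \<in> polys_below k" "[:1, 1:] ^ k * (T_map ^^ k) g = [:0, 1:] ^ j * g + d"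
    using T_map_funpow_affine[of k g] unfolding odd_count_g by blast
  have "[:0, 1:] ^ j * (f - g) = d - c" using c(2) d(2) same_value by (simp add: algebra_simps)
  then have "[:0, 1:] ^ j * (f - g) \<in> polys_below k" using c(1) d(1) by (simp add: polys_below_diff)
  then have "j + degree (f - g) < k"
    using False by (simp add: polys_below_def degree_mult_eq degree_power_eq)
  then have "degree (f - g) < n - degree ((T_map ^^ k) f)" using degree_iterate by linarith
  then show ?thesis by (simp add: polys_below_def)
qed

lemma card_T_map_fiber_le:
  "card {f \<in> polys_of_degree n. (T_map ^^ k) f = g} \<le> 2 ^ (n - degree g)" (is "card ?A \<le> _")
proof (cases "?A = {}")
  case False
  then obtain h where h: "h \<in> ?A" by blast
  have "(\<lambda>f. f - h) ` ?A \<subseteq> polys_below (n - degree g)"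
    using T_map_funpow_eq_imp_diff[of _ n h k] h by auto
  then have "card ?A \<le> card (polys_below (n - degree g) :: bit poly set)"
    by (intro card_inj_on_le finite_polys_below_bit) (auto simp: inj_on_def)
  then show ?thesis by (simp add: card_polys_below card_UNIV_bit)
qed (simp only: card.empty)

section \<open>The stopping time\<close>

text \<open>A run of odd steps from \<open>f\<close> has the same parities as the orbit of the fixed point \<open>1\<close>,
  so it cannot be longer than \<open>degree f\<close>.\<close>
lemma T_map_funpow_degree_less:
  assumes "degree f > 0"
  shows "degree ((T_map ^^ Suc (degree f)) f) < degree f"
proof -
  let ?k = "Suc (degree f)"
  have "f - 1 \<in> polys_below ?k"
    by (intro polys_below_diff) (auto simp: polys_below_def)
  moreover have "f \<noteq> 1" using assms by auto
  ultimately have "odd_times ?k f \<noteq> odd_times ?k 1" using odd_times_eq_imp_eq by blast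
  then have "odd_times ?k f \<subset> {..<?k}" using odd_times_subset odd_times_1 by blast
  then have "card (odd_times ?k f) < card {..<?k}" by (intro psubset_card_mono) auto
  moreover have "f \<noteq> 0" using assms by auto
  ultimately show ?thesis using degree_T_map_funpow[of f ?k] by simp
qed

lemma T_map_reaches_1:
  assumes "f \<noteq> 0"
  shows "\<exists>k \<le> (Suc (degree f))\<^sup>2. (T_map ^^ k) f = 1"
  using assms
proof (induction "degree f" arbitrary: f rule: less_induct)
  case less
  show ?case
  proof (cases "degree f = 0")
    case True
    then have "f = 1" using degree_0_bit less.prems by blast
    then show ?thesis by auto
  next
    case False
    define g where "g = (T_map ^^ Suc (degree f)) f"
    have "degree g < degree f" unfolding g_def using False by (intro T_map_funpow_degree_less) simp
    moreover have "g \<noteq> 0" unfolding g_def using less.prems by (rule T_map_funpow_nonzero)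
    ultimately obtain k where k: "k \<le> (Suc (degree g))\<^sup>2" "(T_map ^^ k) g = 1"
      using less.hyps by blast
    have "(Suc (degree g))\<^sup>2 \<le> (degree f)\<^sup>2" using \<open>degree g < degree f\<close> by (intro power_mono) auto
    then have "k + Suc (degree f) \<le> (Suc (degree f))\<^sup>2" using k(1) by (simp add: power2_eq_square)
    moreover have "(T_map ^^ (k + Suc (degree f))) f = 1"
      using k(2) by (simp only: funpow_add comp_apply g_def)
    ultimately show ?thesis by blast
  qed
qed

lemma tau_le_iff:
  assumes "f \<noteq> 0"
  shows "tau f \<le> k \<longleftrightarrow> (T_map ^^ k) f = 1"
proof
  have "(T_map ^^ tau f) f = 1"
    unfolding tau_def using T_map_reaches_1[OF assms] by (metis (mono_tags, lifting) LeastI)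
  then show "(T_map ^^ k) f = 1" if "tau f \<le> k"
    using funpow_add[of "k - tau f" "tau f" T_map] that by simp
qed (simp add: tau_def Least_le)

lemma tau_le_square: "f \<noteq> 0 \<Longrightarrow> tau f \<le> (Suc (degree f))\<^sup>2"
  using T_map_reaches_1 tau_le_iff by (meson order_trans)

lemma degree_le_tau: "f \<noteq> 0 \<Longrightarrow> degree f \<le> tau f"
  using degree_T_map_funpow[of f "tau f"] tau_le_iff[of f "tau f"] by simp

lemma tau_T_map_funpow:
  assumes "f \<noteq> 0"
  shows "tau ((T_map ^^ k) f) = tau f - k"
proof -
  have "tau ((T_map ^^ k) f) \<le> i \<longleftrightarrow> tau f - k \<le> i" for i
    using tau_le_iff[OF assms, of "i + k"] tau_le_iff[OF T_map_funpow_nonzero[OF assms], of k i]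
    by (simp add: funpow_add le_diff_conv)
  then show ?thesis by (meson order_antisym order_refl)
qed

section \<open>Typical polynomials nearly halve their degree\<close>

lemma map_pmf_card_Pow:
  assumes "finite A"
  shows "map_pmf card (pmf_of_set (Pow A)) = binomial_pmf (card A) (1 / 2)"
  using assms by (simp add: binomial_pmf_altdef'[of A _ _ False] map_pmf_comp
      flip: pmf_of_set_Pow_conv_bernoulli[of A False])

lemma card_Pow_deviation_le:
  assumes "finite A" "0 \<le> \<delta>"
  shows "real (card {S \<in> Pow A. \<bar>real (card S) - real (card A) / 2\<bar> > \<delta> * real (card A)})
    \<le> 2 * exp (- 2 * \<delta>\<^sup>2 * real (card A)) * 2 ^ card A" (is "real (card ?D) \<le> _")
proof (cases "A = {}")
  case False
  define m where "m = card A"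
  define X where "X = {k. \<bar>real k - real m * (1 / 2)\<bar> \<ge> \<delta> * real m}"
  have "m > 0" using assms(1) False by (simp add: m_def card_gt_0_iff)
  interpret binomial_distribution m "1 / 2" by standard simp
  have "real (card ?D) / 2 ^ m \<le> real (card (Pow A \<inter> card -` X)) / 2 ^ m"
    using assms(1) by (intro divide_right_mono of_nat_mono card_mono) (auto simp: X_def m_def)
  also have "\<dots> = measure_pmf.prob (map_pmf card (pmf_of_set (Pow A))) X"
    using assms(1) by (simp add: measure_pmf_of_set card_Pow m_def Pow_not_empty)
  also have "\<dots> \<le> 2 * exp (- 2 * (\<delta> * real m)\<^sup>2 / real m)"
    unfolding X_def map_pmf_card_Pow[OF assms(1)] m_def[symmetric]
    using assms(2) \<open>m > 0\<close> by (intro prob_abs_ge) auto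
  also have "- 2 * (\<delta> * real m)\<^sup>2 / real m = - 2 * \<delta>\<^sup>2 * real m"
    using \<open>m > 0\<close> by (simp add: power2_eq_square)
  finally show ?thesis by (simp add: m_def field_simps)
qed (simp cong: conj_cong)

definition almost_halving :: "real \<Rightarrow> bit poly \<Rightarrow> bool" where
  "almost_halving \<delta> f \<longleftrightarrow>
    \<bar>real (degree ((T_map ^^ degree f) f)) - real (degree f) / 2\<bar> \<le> \<delta> * real (degree f)"

lemma card_not_almost_halving_le:
  assumes "0 \<le> \<delta>"
  shows "real (card {f \<in> polys_of_degree m. \<not> almost_halving \<delta> f})
    \<le> 2 * exp (- 2 * \<delta>\<^sup>2 * real m) * 2 ^ m" (is "real (card ?A) \<le> _")
proof -
  let ?D = "{S \<in> Pow {..<m}. \<bar>real (card S) - real m / 2\<bar> > \<delta> * real m}"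
  have "inj_on (odd_times m) ?A" using inj_on_odd_times by (rule inj_on_subset) auto
  moreover have "odd_times m ` ?A \<subseteq> ?D"
    using odd_times_subset degree_T_map_funpow_degree
    by (auto simp: almost_halving_def polys_of_degree_def)
  ultimately have "card ?A \<le> card ?D" by (intro card_inj_on_le) auto
  also have "real (card ?D) \<le> 2 * exp (- 2 * \<delta>\<^sup>2 * real m) * 2 ^ m"
    using card_Pow_deviation_le[of "{..<m}"] assms by simp
  finally show ?thesis by simp
qed

lemma card_large_not_almost_halving_le:
  assumes "0 \<le> \<delta>"
  shows "real (card ({g. M \<le> degree g \<and> \<not> almost_halving \<delta> g} \<inter> polys_of_degree m))
    \<le> 2 * exp (- 2 * \<delta>\<^sup>2 * real M) * 2 ^ m" (is "real (card (?B \<inter> _)) \<le> _")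
proof (cases "M \<le> m")
  case True
  then have "?B \<inter> polys_of_degree m = {f \<in> polys_of_degree m. \<not> almost_halving \<delta> f}"
    by (auto simp: polys_of_degree_def)
  then have "real (card (?B \<inter> polys_of_degree m)) \<le> 2 * exp (- 2 * \<delta>\<^sup>2 * real m) * 2 ^ m"
    using card_not_almost_halving_le[OF assms] by simp
  also have "\<dots> \<le> 2 * exp (- 2 * \<delta>\<^sup>2 * real M) * 2 ^ m"
    using True by (simp add: mult_left_mono)
  finally show ?thesis .
next
  case False
  then have empty: "?B \<inter> polys_of_degree m = {}" by (auto simp: polys_of_degree_def)
  show ?thesis unfolding empty by simp
qed

lemma card_T_map_vimage_le:
  assumes density: "\<And>m. real (card (B \<inter> polys_of_degree m)) \<le> \<beta> * 2 ^ m"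
  shows "real (card {f \<in> polys_of_degree n. (T_map ^^ t) f \<in> B}) \<le> real (n + 1) * (\<beta> * 2 ^ n)"
    (is "real (card ?A) \<le> _")
proof -
  let ?fiber = "\<lambda>g. {f \<in> polys_of_degree n. (T_map ^^ t) f = g}"
  let ?U = "\<Union>m\<le>n. \<Union>g \<in> B \<inter> polys_of_degree m. ?fiber g"
  have "?A \<subseteq> ?U"
    using T_map_funpow_nonzero degree_T_map_funpow_le by (auto simp: polys_of_degree_def)
  moreover have "finite ?U"
    by (rule finite_subset[OF _ finite_polys_of_degree_bit[of n]]) auto
  ultimately have "card ?A \<le> card ?U" by (intro card_mono)
  also have "\<dots> \<le> (\<Sum>m\<le>n. \<Sum>g \<in> B \<inter> polys_of_degree m. card (?fiber g))"
    by (intro order_trans[OF card_UN_le] sum_mono) (auto simp: finite_polys_of_degree_bit)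
  also have "\<dots> \<le> (\<Sum>m\<le>n. \<Sum>g \<in> B \<inter> polys_of_degree m. 2 ^ (n - m))"
    using card_T_map_fiber_le[of n t] by (intro sum_mono) (auto simp: polys_of_degree_def)
  finally have "real (card ?A) \<le> real (\<Sum>m\<le>n. \<Sum>g \<in> B \<inter> polys_of_degree m. 2 ^ (n - m))"
    by (rule of_nat_mono)
  also have "\<dots> = (\<Sum>m\<le>n. real (card (B \<inter> polys_of_degree m)) * 2 ^ (n - m))" by simp
  also have "\<dots> \<le> (\<Sum>m\<le>n. \<beta> * 2 ^ m * 2 ^ (n - m))"
    using density by (intro sum_mono mult_right_mono) auto
  also have "\<dots> = (\<Sum>m\<le>n. \<beta> * 2 ^ n)"
    by (intro sum.cong) (simp_all flip: power_add)
  finally show ?thesis by simp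
qed

definition orbit_almost_halving :: "real \<Rightarrow> nat \<Rightarrow> bit poly \<Rightarrow> bool" where
  "orbit_almost_halving \<delta> M f \<longleftrightarrow>
    (\<forall>t. M \<le> degree ((T_map ^^ t) f) \<longrightarrow> almost_halving \<delta> ((T_map ^^ t) f))"

lemma orbit_almost_halving_T_map_funpow:
  assumes "orbit_almost_halving \<delta> M f"
  shows "orbit_almost_halving \<delta> M ((T_map ^^ k) f)"
  unfolding orbit_almost_halving_def
proof
  fix t
  show "M \<le> degree ((T_map ^^ t) ((T_map ^^ k) f)) \<longrightarrow>
      almost_halving \<delta> ((T_map ^^ t) ((T_map ^^ k) f))"
    using assms[unfolded orbit_almost_halving_def, THEN spec, of "t + k"] by (simp add: funpow_add)
qed

lemma not_orbit_almost_halving_early: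
  assumes "f \<noteq> 0" "\<not> orbit_almost_halving \<delta> M f"
  shows "\<exists>t < (Suc (degree f))\<^sup>2. M \<le> degree ((T_map ^^ t) f) \<and> \<not> almost_halving \<delta> ((T_map ^^ t) f)"
proof -
  obtain t where t: "M \<le> degree ((T_map ^^ t) f)" "\<not> almost_halving \<delta> ((T_map ^^ t) f)"
    using assms(2) by (auto simp: orbit_almost_halving_def)
  have "almost_halving \<delta> 1" by (simp add: almost_halving_def)
  then have "t < tau f" using tau_le_iff[OF assms(1), of t] t(2) by force
  then have "t < (Suc (degree f))\<^sup>2" using tau_le_square[OF assms(1)] by simp
  with t show ?thesis by blast
qed

lemma card_not_orbit_almost_halving_le:
  assumes "0 \<le> \<delta>"
  shows "real (card {f \<in> polys_of_degree n. \<not> orbit_almost_halving \<delta> M f})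
    \<le> 2 * real (n + 1) ^ 3 * exp (- 2 * \<delta>\<^sup>2 * real M) * 2 ^ n" (is "real (card ?A) \<le> _")
proof -
  let ?V = "\<lambda>t. {f \<in> polys_of_degree n.
    (T_map ^^ t) f \<in> {g. M \<le> degree g \<and> \<not> almost_halving \<delta> g}}"
  have "?A \<subseteq> (\<Union>t<(n + 1)\<^sup>2. ?V t)"
    using not_orbit_almost_halving_early by (fastforce simp: polys_of_degree_def)
  then have "card ?A \<le> card (\<Union>t<(n + 1)\<^sup>2. ?V t)"
    by (intro card_mono) (auto simp: finite_polys_of_degree_bit)
  also have "\<dots> \<le> (\<Sum>t<(n + 1)\<^sup>2. card (?V t))" by (rule card_UN_le) simp
  finally have "real (card ?A) \<le> real (\<Sum>t<(n + 1)\<^sup>2. card (?V t))" by (rule of_nat_mono)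
  also have "\<dots> = (\<Sum>t<(n + 1)\<^sup>2. real (card (?V t)))" by simp
  also have "\<dots> \<le> (\<Sum>t<(n + 1)\<^sup>2. real (n + 1) * (2 * exp (- 2 * \<delta>\<^sup>2 * real M) * 2 ^ n))"
    using assms by (intro sum_mono card_T_map_vimage_le card_large_not_almost_halving_le)
  also have "\<dots> = 2 * real (n + 1) ^ 3 * exp (- 2 * \<delta>\<^sup>2 * real M) * 2 ^ n"
    by (simp add: power3_eq_cube power2_eq_square algebra_simps)
  finally show ?thesis .
qed

section \<open>Concentration of the stopping time\<close>

lemma tau_deviation_small_degree:
  assumes "f \<noteq> 0" "degree f < M"
  shows "\<bar>real (tau f) - 2 * real (degree f)\<bar> \<le> (real M)\<^sup>2"
proof -
  let ?s = "(real (degree f) + 1)\<^sup>2"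
  have "real (tau f) \<le> ?s"
    using of_nat_mono[OF tau_le_square[OF assms(1)], where 'a = real] by (simp add: add.commute)
  moreover have "2 * real (degree f) \<le> ?s" by (simp add: power2_eq_square algebra_simps)
  moreover have "?s \<le> (real M)\<^sup>2" using assms(2) by (intro power_mono) auto
  ultimately show ?thesis by linarith
qed

lemma almost_halving_degree_less:
  assumes "almost_halving \<delta> f" "\<delta> < 1 / 2" "degree f > 0"
  shows "degree ((T_map ^^ degree f) f) < degree f"
proof -
  have "\<delta> * real (degree f) < 1 / 2 * real (degree f)"
    using assms(2,3) by (intro mult_strict_right_mono) auto
  then show ?thesis using assms(1) by (simp add: almost_halving_def)
qed

lemma tau_deviation_halving:
  fixes f :: "bit poly"
  defines "g \<equiv> (T_map ^^ degree f) f"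
  assumes "f \<noteq> 0" "almost_halving \<delta> f" "0 \<le> \<eta>" "4 * \<delta> \<le> \<eta> * (1 - 2 * \<delta>)"
    and "\<bar>real (tau g) - 2 * real (degree g)\<bar> \<le> \<eta> * real (degree g) + c"
  shows "\<bar>real (tau f) - 2 * real (degree f)\<bar> \<le> \<eta> * real (degree f) + c"
proof -
  define m where "m = real (degree f)"
  have "real (tau f) = m + real (tau g)"
    using tau_T_map_funpow[OF assms(2)] degree_le_tau[OF assms(2)] by (simp add: g_def m_def)
  moreover have halving: "\<bar>real (degree g) - m / 2\<bar> \<le> \<delta> * m"
    using assms(3) by (simp add: almost_halving_def g_def m_def)
  ultimately have "\<bar>real (tau f) - 2 * m\<bar> \<le> \<eta> * real (degree g) + c + 2 * (\<delta> * m)"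
    using assms(6) by linarith
  also have "\<eta> * real (degree g) \<le> \<eta> * (m / 2 + \<delta> * m)"
    using halving assms(4) by (intro mult_left_mono) auto
  also have "\<eta> * (m / 2 + \<delta> * m) + c + 2 * (\<delta> * m) \<le> \<eta> * m + c"
    using mult_right_mono[OF assms(5), of m] by (simp add: m_def algebra_simps)
  finally show ?thesis by (simp add: m_def)
qed

lemma tau_deviation_le:
  fixes \<delta> \<eta> :: real
  assumes "\<delta> < 1 / 2" "0 \<le> \<eta>" "4 * \<delta> \<le> \<eta> * (1 - 2 * \<delta>)"
    and "f \<noteq> 0" "orbit_almost_halving \<delta> M f"
  shows "\<bar>real (tau f) - 2 * real (degree f)\<bar> \<le> \<eta> * real (degree f) + (real M)\<^sup>2"
  using assms(4,5)
proof (induction "degree f" arbitrary: f rule: less_induct)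
  case less
  consider (zero) "degree f = 0" | (small) "degree f < M" | (large) "degree f > 0" "M \<le> degree f"
    by linarith
  then show ?case
  proof cases
    case zero
    then have "f = 1" using degree_0_bit less.prems by blast
    then have "tau f = 0" using tau_le_iff[of 1 0] by simp
    then show ?thesis using zero by simp
  next
    case small
    then have "\<bar>real (tau f) - 2 * real (degree f)\<bar> \<le> (real M)\<^sup>2"
      by (rule tau_deviation_small_degree[OF less.prems(1)])
    then show ?thesis using assms(2) by (simp add: add_increasing)
  next
    case large
    have halving: "almost_halving \<delta> f"
      using less.prems(2) large(2) by (auto simp: orbit_almost_halving_def dest: spec[of _ 0])
    show ?thesis
    proof (rule tau_deviation_halving[OF less.prems(1) halving assms(2,3)], rule less.hyps)
      show "degree ((T_map ^^ degree f) f) < degree f"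
        using halving assms(1) large(1) by (rule almost_halving_degree_less)
    qed (use less.prems T_map_funpow_nonzero orbit_almost_halving_T_map_funpow in auto)
  qed
qed

lemma power_le_exp_sqrt:
  fixes a :: real
  assumes "a > 0"
  shows "\<exists>K>0. \<forall>n. real (n + 1) ^ k \<le> K * exp (a * sqrt (real n))"
proof -
  have "(\<lambda>n. real (n + 1) ^ k * exp (- (a * sqrt (real n)))) \<longlonglongrightarrow> 0"
    using assms by real_asymp
  then have "Bseq (\<lambda>n. real (n + 1) ^ k * exp (- (a * sqrt (real n))))"
    by (intro convergent_imp_Bseq convergentI)
  then obtain K where "K > 0" "\<And>n. norm (real (n + 1) ^ k * exp (- (a * sqrt (real n)))) \<le> K"
    by (auto elim: BseqE)
  then show ?thesis by (auto simp: exp_minus field_simps)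
qed

definition tau_deviating :: "real \<Rightarrow> nat \<Rightarrow> bit poly set" where
  "tau_deviating \<epsilon> n = {f \<in> polys_of_degree n. \<bar>real (tau f) - 2 * real n\<bar> > \<epsilon> * real n}"

lemma tau_deviating_subset: "tau_deviating \<epsilon> n \<subseteq> polys_of_degree n"
  by (auto simp: tau_deviating_def)

lemma finite_tau_deviating: "finite (tau_deviating \<epsilon> n)"
  using tau_deviating_subset finite_polys_of_degree_bit by (rule finite_subset)

lemma card_tau_deviating_le:
  assumes "\<epsilon> > 0" "(real M)\<^sup>2 \<le> \<epsilon> / 2 * real n"
  shows "real (card (tau_deviating \<epsilon> n))
    \<le> 2 * real (n + 1) ^ 3 * exp (- 2 * (\<epsilon> / (8 + 2 * \<epsilon>))\<^sup>2 * real M) * 2 ^ n"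
proof -
  define \<delta> where "\<delta> = \<epsilon> / (8 + 2 * \<epsilon>)"
  have \<delta>: "0 \<le> \<delta>" "\<delta> < 1 / 2" "4 * \<delta> = \<epsilon> / 2 * (1 - 2 * \<delta>)"
    using assms(1) by (auto simp: \<delta>_def field_simps)
  have "tau_deviating \<epsilon> n \<subseteq> {f \<in> polys_of_degree n. \<not> orbit_almost_halving \<delta> M f}"
    using tau_deviation_le[OF \<delta>(2) _ eq_refl[OF \<delta>(3)], of _ M] assms
    by (fastforce simp: tau_deviating_def polys_of_degree_def)
  then have "card (tau_deviating \<epsilon> n) \<le>
      card {f \<in> polys_of_degree n. \<not> orbit_almost_halving \<delta> M f}"
    by (intro card_mono) (auto simp: finite_polys_of_degree_bit)
  then show ?thesis
    using card_not_orbit_almost_halving_le[OF \<delta>(1), of n M] unfolding \<delta>_def by linarith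
qed

lemma tau_concentration:
  fixes \<epsilon> :: real
  assumes "\<epsilon> > 0"
  shows "\<exists>C>0. \<exists>D>0. \<forall>n.
    real (card (tau_deviating \<epsilon> n)) \<le> C * exp (- D * sqrt (real n)) * 2 ^ n"
proof -
  define b where "b = 2 * (\<epsilon> / (8 + 2 * \<epsilon>))\<^sup>2"
  define D where "D = b * sqrt (\<epsilon> / 2) / 2"
  have b: "b > 0" using assms by (simp add: b_def)
  then have D: "D > 0" using assms by (simp add: D_def)
  then obtain K where "K > 0" and power_le: "\<And>n. real (n + 1) ^ 3 \<le> K * exp (D * sqrt (real n))"
    using power_le_exp_sqrt by blast
  define C where "C = 2 * K * exp b"
  have "real (card (tau_deviating \<epsilon> n)) \<le> C * exp (- D * sqrt (real n)) * 2 ^ n" for n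
  proof -
    define r where "r = sqrt (\<epsilon> / 2 * real n)"
    define M where "M = nat \<lfloor>r\<rfloor>"
    have "r \<ge> 0" using assms by (simp add: r_def)
    then have M: "real M \<le> r" "r - 1 \<le> real M" by (auto simp: M_def of_nat_nat)
    have "(real M)\<^sup>2 \<le> r\<^sup>2" using M(1) by (intro power_mono) auto
    then have M_square: "(real M)\<^sup>2 \<le> \<epsilon> / 2 * real n" using assms by (simp add: r_def)
    have "r = sqrt (\<epsilon> / 2) * sqrt (real n)" by (simp add: r_def flip: real_sqrt_mult)
    then have exp_split: "exp (- b * (r - 1)) = exp b * exp (- 2 * D * sqrt (real n))"
      by (simp add: D_def mult_exp_exp algebra_simps)
    have "real (card (tau_deviating \<epsilon> n)) \<le> 2 * real (n + 1) ^ 3 * exp (- b * real M) * 2 ^ n"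
      using card_tau_deviating_le[OF assms M_square] by (simp add: b_def)
    also have "\<dots> \<le> 2 * (K * exp (D * sqrt (real n))) * exp (- b * (r - 1)) * 2 ^ n"
      using power_le M(2) b \<open>K > 0\<close> by (intro mult_mono) auto
    also have "\<dots> = C * exp (- D * sqrt (real n)) * 2 ^ n"
      using exp_split by (simp add: C_def mult_exp_exp)
    finally show ?thesis .
  qed
  moreover have "C > 0" using \<open>K > 0\<close> by (simp add: C_def)
  ultimately show ?thesis using D by blast
qed

theorem theorem2p15:
  fixes \<epsilon> :: real
  assumes "\<epsilon> > 0"
  shows "\<exists>C D. C > 0 \<and> D > 0 \<and> (\<forall>n::nat.
           real (card {f :: bit poly. f \<noteq> 0 \<and> degree f = n \<and>
                  (2 - \<epsilon>) * real n \<le> real (tau f) \<and> real (tau f) \<le> (2 + \<epsilon>) * real n})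
             / 2 ^ n
           \<ge> 1 - C * exp (- D * sqrt (real n)))"
proof -
  obtain C D where "C > 0" "D > 0"
    and tail: "\<And>n. real (card (tau_deviating \<epsilon> n)) \<le> C * exp (- D * sqrt (real n)) * 2 ^ n"
    using tau_concentration[OF assms] by blast
  have "1 - C * exp (- D * sqrt (real n)) \<le> real (card {f :: bit poly. f \<noteq> 0 \<and> degree f = n \<and>
      (2 - \<epsilon>) * real n \<le> real (tau f) \<and> real (tau f) \<le> (2 + \<epsilon>) * real n}) / 2 ^ n"
    (is "_ \<le> real (card ?G) / _") for n
  proof -
    have "?G = polys_of_degree n - tau_deviating \<epsilon> n"
      by (auto simp: tau_deviating_def polys_of_degree_def abs_if algebra_simps)
    then have "2 ^ n \<le> card ?G + card (tau_deviating \<epsilon> n)"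
      by (simp add: card_polys_of_degree_bit finite_tau_deviating
          tau_deviating_subset card_Diff_subset)
    then have "real (2 ^ n) \<le> real (card ?G + card (tau_deviating \<epsilon> n))" by (rule of_nat_mono)
    then show ?thesis using tail[of n] by (simp add: field_simps)
  qed
  then show ?thesis using \<open>C > 0\<close> \<open>D > 0\<close> by blast
qed

end
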